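(* Let $\Theta\subseteq\mathbb{R}^d$ be nonempty, compact and convex and fix $\theta^\star\in\Theta$. Let $Z\sim N(0,I_d)$ and for $\sigma>0$ define $\hat\theta_\sigma:=\Pi_\Theta(\theta^\star+\sigma Z)$. Set $U:=Z/\|Z\|$ and, for $u\in\mathcal{S}^{d-1}$, $F_\Theta(u):=\arg\max_{\theta\in\Theta}\langle\theta,u\rangle$ (the set of all maximizers, i.e. the exposed face of $\Theta$ in direction $u$). Then, almost surely as $\sigma\to\infty$, $$\hat\theta_\sigma\to\Pi_{F_\Theta(U)}(\theta^\star),$$ and consequently, for $R_\infty(\theta^\star;\Theta):=\mathbb{E}\|\Pi_{F_\Theta(U)}(\theta^\star)-\theta^\star\|^2$, $$R_\sigma(\theta^\star;\Theta)\to R_\infty(\theta^\star;\Theta)\qquad\text{as }\sigma\to\infty.$$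
   Context: For a nonempty compact convex set $K\subseteq\mathbb{R}^d$, $\Pi_K(y)=\arg\min_{\theta\in K}\|y-\theta\|^2$ is the Euclidean projection. $\mathcal{S}^{d-1}$ is the unit sphere in $\mathbb{R}^d$. The risk is $R_\sigma(\theta^\star;\Theta)=\mathbb{E}\|\Pi_\Theta(\theta^\star+\sigma Z)-\theta^\star\|^2$. $U$ is defined on the probability-one event $\{Z\neq0\}$. *)

theory Defs
  imports "HOL-Probability.Probability"
begin

text \<open>
  The Euclidean projection onto a nonempty compact convex set is the library's
  \<^const>\<open>closest_point\<close>; \<open>\<real>\<^sup>d\<close> is \<^typ>\<open>real ^ 'd\<close>.
\<close>

text \<open>Lebesgue density of the standard Gaussian law \<open>N(0, I\<^sub>d)\<close>.\<close>

definition std_gaussian_density :: "real ^ 'd \<Rightarrow> real" where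
  "std_gaussian_density z = (2 * pi) powr (- (real CARD('d) / 2)) * exp (- ((norm z)\<^sup>2 / 2))"

definition exposed_face :: "(real ^ 'd) set \<Rightarrow> real ^ 'd \<Rightarrow> (real ^ 'd) set" where
  "exposed_face \<Theta> u = {\<theta>. is_arg_max (\<lambda>\<theta>'. \<theta>' \<bullet> u) (\<lambda>\<theta>'. \<theta>' \<in> \<Theta>) \<theta>}"

definition proj_estimator ::
    "(real ^ 'd) set \<Rightarrow> real ^ 'd \<Rightarrow> ('w \<Rightarrow> real ^ 'd) \<Rightarrow> real \<Rightarrow> 'w \<Rightarrow> real ^ 'd" where
  "proj_estimator \<Theta> \<theta>\<^sub>0 Z \<sigma> \<omega> = closest_point \<Theta> (\<theta>\<^sub>0 + \<sigma> *\<^sub>R Z \<omega>)"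

text \<open>
  The direction \<open>Z / \<parallel>Z\<parallel>\<close>. It takes the value \<open>0\<close> on the event \<open>Z = 0\<close>,
  which is null when \<open>Z\<close> is Gaussian.
\<close>

definition direction :: "('w \<Rightarrow> real ^ 'd) \<Rightarrow> 'w \<Rightarrow> real ^ 'd" where
  "direction Z \<omega> = (1 / norm (Z \<omega>)) *\<^sub>R Z \<omega>"

definition limit_estimator ::
    "(real ^ 'd) set \<Rightarrow> real ^ 'd \<Rightarrow> ('w \<Rightarrow> real ^ 'd) \<Rightarrow> 'w \<Rightarrow> real ^ 'd" where
  "limit_estimator \<Theta> \<theta>\<^sub>0 Z \<omega> = closest_point (exposed_face \<Theta> (direction Z \<omega>)) \<theta>\<^sub>0"

definition risk ::
    "'w measure \<Rightarrow> ('w \<Rightarrow> real ^ 'd) \<Rightarrow> real ^ 'd \<Rightarrow> (real ^ 'd) set \<Rightarrow> real \<Rightarrow> real" where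
  "risk M Z \<theta>\<^sub>0 \<Theta> \<sigma> = (\<integral>\<omega>. (norm (proj_estimator \<Theta> \<theta>\<^sub>0 Z \<sigma> \<omega> - \<theta>\<^sub>0))\<^sup>2 \<partial>M)"

definition limit_risk ::
    "'w measure \<Rightarrow> ('w \<Rightarrow> real ^ 'd) \<Rightarrow> real ^ 'd \<Rightarrow> (real ^ 'd) set \<Rightarrow> real" where
  "limit_risk M Z \<theta>\<^sub>0 \<Theta> = (\<integral>\<omega>. (norm (limit_estimator \<Theta> \<theta>\<^sub>0 Z \<omega> - \<theta>\<^sub>0))\<^sup>2 \<partial>M)"

end

theory Submission
  imports Defs
begin

text \<open>
  Comparing the squared distances from \<open>\<theta>\<^sub>0 + \<sigma> z\<close> to its projection \<open>q\<close> and to any other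
  \<open>\<theta> \<in> \<Theta>\<close>, the term \<open>\<sigma>\<^sup>2 \<parallel>z\<parallel>\<^sup>2\<close> cancels: \<open>q\<close> minimizes
  \<open>\<parallel>\<theta> - \<theta>\<^sub>0\<parallel>\<^sup>2 - 2 \<sigma> \<langle>\<theta>, z\<rangle>\<close> over \<open>\<Theta>\<close>. For large \<open>\<sigma>\<close> the linear term dominates and forces
  \<open>q\<close> towards the face \<open>F\<close> exposed by \<open>z\<close>, while the quadratic term acts as a tie-break: taking
  for \<open>\<theta>\<close> the point \<open>p\<close> of \<open>F\<close> nearest to \<open>\<theta>\<^sub>0\<close> shows that \<open>q\<close> is never farther from
  \<open>\<theta>\<^sub>0\<close> than \<open>p\<close>, and that the value \<open>\<langle>q, z\<rangle>\<close> falls short of the maximum by at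
  most \<open>\<parallel>p - \<theta>\<^sub>0\<parallel>\<^sup>2 / (2 \<sigma>)\<close> (\<open>closest_point_tradeoff\<close>). By compactness of \<open>\<Theta>\<close> and uniqueness
  of \<open>p\<close>, these two facts give \<open>q \<longlonglongrightarrow> p\<close> (\<open>closest_point_tendsto_exposed_face\<close>).

  The convergence is deterministic and holds for every outcome. Both estimators stay in the bounded
  set \<open>\<Theta>\<close>, so the risks converge by dominated convergence with a constant bound; the limit is
  measurable as a pointwise limit of continuous functions of \<open>Z\<close>.
\<close>

lemma mem_exposed_face_iff:
  "\<theta> \<in> exposed_face \<Theta> u \<longleftrightarrow> \<theta> \<in> \<Theta> \<and> (\<forall>y\<in>\<Theta>. y \<bullet> u \<le> \<theta> \<bullet> u)"
  by (auto simp: exposed_face_def is_arg_max_def not_less)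

lemma exposed_face_subset: "exposed_face \<Theta> u \<subseteq> \<Theta>"
  by (auto simp: mem_exposed_face_iff)

lemma exposed_face_nonempty:
  assumes "\<Theta> \<noteq> {}" "compact \<Theta>"
  shows "exposed_face \<Theta> u \<noteq> {}"
proof -
  have "continuous_on \<Theta> (\<lambda>y. y \<bullet> u)"
    by (intro continuous_intros)
  then obtain \<theta> where "\<theta> \<in> \<Theta>" "\<forall>y\<in>\<Theta>. y \<bullet> u \<le> \<theta> \<bullet> u"
    using continuous_attains_sup[OF assms(2,1)] by blast
  then show ?thesis
    using mem_exposed_face_iff by blast
qed

lemma exposed_face_eq:
  "exposed_face \<Theta> u = \<Theta> \<inter> (\<Inter>y\<in>\<Theta>. {\<theta>. y \<bullet> u \<le> u \<bullet> \<theta>})"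
  by (auto simp: mem_exposed_face_iff inner_commute)

lemma closed_exposed_face: "closed \<Theta> \<Longrightarrow> closed (exposed_face \<Theta> u)"
  unfolding exposed_face_eq
  by (intro closed_Int closed_INT) (auto simp: closed_halfspace_ge)

lemma convex_exposed_face: "convex \<Theta> \<Longrightarrow> convex (exposed_face \<Theta> u)"
  unfolding exposed_face_eq
  by (intro convex_Int convex_INT) (auto simp: convex_halfspace_ge)

lemma exposed_face_scaleR:
  assumes "c > 0"
  shows "exposed_face \<Theta> (c *\<^sub>R u) = exposed_face \<Theta> u"
  using assms by (auto simp: mem_exposed_face_iff)

text \<open>
  At \<open>Z \<omega> = 0\<close> the conventional direction \<open>0\<close> exposes all of \<open>\<Theta>\<close>, exactly as \<open>Z \<omega>\<close> itself does,
  so the normalization is harmless for every outcome.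
\<close>

lemma exposed_face_direction:
  "exposed_face \<Theta> (direction Z \<omega>) = exposed_face \<Theta> (Z \<omega>)"
proof (cases "Z \<omega> = 0")
  case False
  then show ?thesis
    unfolding direction_def by (intro exposed_face_scaleR) simp
qed (simp add: direction_def)

text \<open>
  This is the minimality of the projection, tested against \<open>p\<close>, after expanding both squares
  around \<open>\<theta>\<^sub>0\<close> and cancelling \<open>\<sigma>\<^sup>2 \<parallel>z\<parallel>\<^sup>2\<close>.
\<close>

lemma closest_point_tradeoff:
  fixes \<Theta> :: "'a::euclidean_space set" and \<theta>\<^sub>0 z :: 'a and \<sigma> :: real
  assumes "closed \<Theta>" "p \<in> \<Theta>"
  defines "q \<equiv> closest_point \<Theta> (\<theta>\<^sub>0 + \<sigma> *\<^sub>R z)"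
  shows "(norm (q - \<theta>\<^sub>0))\<^sup>2 + 2 * \<sigma> * (p \<bullet> z - q \<bullet> z) \<le> (norm (p - \<theta>\<^sub>0))\<^sup>2"
proof -
  have expand: "(dist (\<theta>\<^sub>0 + \<sigma> *\<^sub>R z) x)\<^sup>2
      = (norm (x - \<theta>\<^sub>0))\<^sup>2 - 2 * \<sigma> * (x \<bullet> z - \<theta>\<^sub>0 \<bullet> z) + \<sigma>\<^sup>2 * (norm z)\<^sup>2" for x
    unfolding dist_norm power2_norm_eq_inner
    by (simp add: inner_diff_left inner_diff_right inner_add_left inner_add_right
        inner_commute power2_eq_square algebra_simps)
  have "dist (\<theta>\<^sub>0 + \<sigma> *\<^sub>R z) q \<le> dist (\<theta>\<^sub>0 + \<sigma> *\<^sub>R z) p"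
    unfolding q_def by (rule closest_point_le) fact+
  then have "(dist (\<theta>\<^sub>0 + \<sigma> *\<^sub>R z) q)\<^sup>2 \<le> (dist (\<theta>\<^sub>0 + \<sigma> *\<^sub>R z) p)\<^sup>2"
    by (intro power_mono) auto
  then show ?thesis
    unfolding expand by (simp add: algebra_simps)
qed

text \<open>
  A point of \<open>\<Theta>\<close> other than \<open>p\<close> either misses the maximum of \<open>\<langle>\<cdot>, z\<rangle>\<close> or is farther from
  \<open>\<theta>\<^sub>0\<close> than \<open>p\<close>, since \<open>p\<close> is the unique nearest point of the face. Away from \<open>p\<close>, compactness makes
  this alternative uniform, and for large \<open>\<sigma>\<close> the projection violates both halves of it.
\<close>

lemma closest_point_tendsto_exposed_face:
  fixes \<Theta> :: "(real ^ 'd) set"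
  assumes "\<Theta> \<noteq> {}" "compact \<Theta>" "convex \<Theta>"
  shows "((\<lambda>\<sigma>. closest_point \<Theta> (\<theta>\<^sub>0 + \<sigma> *\<^sub>R z))
           \<longlongrightarrow> closest_point (exposed_face \<Theta> z) \<theta>\<^sub>0) at_top"
proof (rule topological_tendstoI)
  define F where "F = exposed_face \<Theta> z"
  define p where "p = closest_point F \<theta>\<^sub>0"
  define q where "q = (\<lambda>\<sigma>. closest_point \<Theta> (\<theta>\<^sub>0 + \<sigma> *\<^sub>R z))"
  have "closed \<Theta>"
    using assms by (simp add: compact_imp_closed)
  have F: "closed F" "convex F" "F \<noteq> {}"
    using assms \<open>closed \<Theta>\<close>
    by (auto simp: F_def closed_exposed_face convex_exposed_face exposed_face_nonempty)
  have "p \<in> F"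
    unfolding p_def using F by (intro closest_point_in_set)
  then have "p \<in> \<Theta>" and max: "\<And>y. y \<in> \<Theta> \<Longrightarrow> y \<bullet> z \<le> p \<bullet> z"
    by (auto simp: F_def mem_exposed_face_iff)
  have q_in: "q \<sigma> \<in> \<Theta>" for \<sigma>
    unfolding q_def using assms \<open>closed \<Theta>\<close> by (intro closest_point_in_set)
  fix V
  assume "open V" and "closest_point (exposed_face \<Theta> z) \<theta>\<^sub>0 \<in> V"
  then have "p \<in> V"
    by (simp add: p_def F_def)
  define gap where
    "gap = (\<lambda>x. max (p \<bullet> z - x \<bullet> z) ((norm (x - \<theta>\<^sub>0))\<^sup>2 - (norm (p - \<theta>\<^sub>0))\<^sup>2))"
  have gap_pos: "gap x > 0" if "x \<in> \<Theta> - V" for x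
  proof (cases "x \<bullet> z < p \<bullet> z")
    case False
    with that max have "x \<in> F"
      by (force simp: F_def mem_exposed_face_iff)
    with that \<open>p \<in> V\<close> have "dist \<theta>\<^sub>0 p < dist \<theta>\<^sub>0 x"
      unfolding p_def using F by (intro closest_point_lt) auto
    then have "(dist \<theta>\<^sub>0 p)\<^sup>2 < (dist \<theta>\<^sub>0 x)\<^sup>2"
      by (intro power_strict_mono) auto
    then show ?thesis
      by (simp add: gap_def dist_norm norm_minus_commute)
  qed (simp add: gap_def)
  obtain m where "m > 0" and m: "\<And>x. x \<in> \<Theta> - V \<Longrightarrow> m \<le> gap x"
  proof (cases "\<Theta> - V = {}")
    case True
    then show ?thesis
      using that[of 1] by auto
  next
    case False
    have "compact (\<Theta> - V)"
      using assms \<open>open V\<close> by (intro compact_diff)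
    moreover have "continuous_on (\<Theta> - V) gap"
      unfolding gap_def by (intro continuous_intros)
    ultimately obtain x where "x \<in> \<Theta> - V" "\<forall>y\<in>\<Theta> - V. gap x \<le> gap y"
      using continuous_attains_inf[OF _ False] by blast
    then show ?thesis
      using that[of "gap x"] gap_pos by auto
  qed
  show "\<forall>\<^sub>F \<sigma> in at_top. closest_point \<Theta> (\<theta>\<^sub>0 + \<sigma> *\<^sub>R z) \<in> V"
    \<comment> \<open>beyond this threshold the shortfall bound \<open>\<parallel>p - \<theta>\<^sub>0\<parallel>\<^sup>2 / (2 \<sigma>)\<close> drops below \<open>m\<close>\<close>
    using eventually_gt_at_top[of "(norm (p - \<theta>\<^sub>0))\<^sup>2 / (2 * m)"]
  proof eventually_elim
    case (elim \<sigma>)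
    have "\<sigma> > 0"
      using elim \<open>m > 0\<close> by (smt (verit) divide_nonneg_nonneg zero_le_power2)
    have tradeoff: "(norm (q \<sigma> - \<theta>\<^sub>0))\<^sup>2 + 2 * \<sigma> * (p \<bullet> z - q \<sigma> \<bullet> z) \<le> (norm (p - \<theta>\<^sub>0))\<^sup>2"
      unfolding q_def by (rule closest_point_tradeoff) fact+
    have "0 \<le> 2 * \<sigma> * (p \<bullet> z - q \<sigma> \<bullet> z)"
      using \<open>\<sigma> > 0\<close> max[OF q_in] by simp
    with tradeoff have near: "(norm (q \<sigma> - \<theta>\<^sub>0))\<^sup>2 \<le> (norm (p - \<theta>\<^sub>0))\<^sup>2"
      by linarith
    have "2 * \<sigma> * (p \<bullet> z - q \<sigma> \<bullet> z) \<le> (norm (p - \<theta>\<^sub>0))\<^sup>2"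
      using tradeoff zero_le_power2[of "norm (q \<sigma> - \<theta>\<^sub>0)"] by linarith
    also have "\<dots> < 2 * \<sigma> * m"
      using elim \<open>m > 0\<close> by (simp add: field_simps)
    finally have "p \<bullet> z - q \<sigma> \<bullet> z < m"
      using \<open>\<sigma> > 0\<close> by simp
    with near \<open>m > 0\<close> have "gap (q \<sigma>) < m"
      unfolding gap_def max_less_iff_conj by (intro conjI; linarith)
    with m[of "q \<sigma>"] q_in[of \<sigma>] have "q \<sigma> \<in> V"
      by force
    then show ?case
      by (simp add: q_def)
  qed
qed

lemma proj_estimator_tendsto_limit_estimator:
  assumes "\<Theta> \<noteq> {}" "compact \<Theta>" "convex \<Theta>"
  shows "((\<lambda>\<sigma>. proj_estimator \<Theta> \<theta>\<^sub>0 Z \<sigma> \<omega>) \<longlongrightarrow> limit_estimator \<Theta> \<theta>\<^sub>0 Z \<omega>) at_top"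
  unfolding proj_estimator_def limit_estimator_def exposed_face_direction
  using assms by (rule closest_point_tendsto_exposed_face)

lemma proj_estimator_in_set:
  assumes "\<Theta> \<noteq> {}" "compact \<Theta>"
  shows "proj_estimator \<Theta> \<theta>\<^sub>0 Z \<sigma> \<omega> \<in> \<Theta>"
  unfolding proj_estimator_def using assms
  by (intro closest_point_in_set compact_imp_closed)

lemma limit_estimator_in_set:
  assumes "\<Theta> \<noteq> {}" "compact \<Theta>"
  shows "limit_estimator \<Theta> \<theta>\<^sub>0 Z \<omega> \<in> \<Theta>"
proof -
  have "limit_estimator \<Theta> \<theta>\<^sub>0 Z \<omega> \<in> exposed_face \<Theta> (direction Z \<omega>)"
    unfolding limit_estimator_def using assms
    by (intro closest_point_in_set closed_exposed_face exposed_face_nonempty compact_imp_closed)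
  then show ?thesis
    using exposed_face_subset by blast
qed

lemma borel_measurable_proj_estimator:
  assumes "\<Theta> \<noteq> {}" "compact \<Theta>" "convex \<Theta>" and [measurable]: "Z \<in> borel_measurable M"
  shows "proj_estimator \<Theta> \<theta>\<^sub>0 Z \<sigma> \<in> borel_measurable M"
proof -
  have "continuous_on UNIV (closest_point \<Theta>)"
    using assms by (intro continuous_on_closest_point compact_imp_closed)
  then have [measurable]: "closest_point \<Theta> \<in> borel_measurable borel"
    by (rule borel_measurable_continuous_onI)
  have "(\<lambda>\<omega>. closest_point \<Theta> (\<theta>\<^sub>0 + \<sigma> *\<^sub>R Z \<omega>)) \<in> borel_measurable M"
    by measurable
  then show ?thesis
    by (simp add: proj_estimator_def[abs_def])
qed

text \<open>
  The nearest point of the exposed face may jump with the direction, so measurability is inherited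
  from the continuous projections along \<open>\<sigma> = 0, 1, 2, \<dots>\<close>.
\<close>

lemma borel_measurable_limit_estimator:
  assumes "\<Theta> \<noteq> {}" "compact \<Theta>" "convex \<Theta>" and "Z \<in> borel_measurable M"
  shows "limit_estimator \<Theta> \<theta>\<^sub>0 Z \<in> borel_measurable M"
proof (rule borel_measurable_LIMSEQ_metric)
  show "proj_estimator \<Theta> \<theta>\<^sub>0 Z (real n) \<in> borel_measurable M" for n
    using assms by (rule borel_measurable_proj_estimator)
  show "(\<lambda>n. proj_estimator \<Theta> \<theta>\<^sub>0 Z (real n) \<omega>) \<longlonglongrightarrow> limit_estimator \<Theta> \<theta>\<^sub>0 Z \<omega>" for \<omega>
    using proj_estimator_tendsto_limit_estimator[OF assms(1-3)] filterlim_real_sequentially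
    by (rule filterlim_compose)
qed

theorem theorem2p3:
  fixes \<Theta> :: "(real ^ 'd) set" and \<theta>\<^sub>0 :: "real ^ 'd"
    and M :: "'w measure" and Z :: "'w \<Rightarrow> real ^ 'd"
  assumes "\<Theta> \<noteq> {}" and "compact \<Theta>" and "convex \<Theta>" and "\<theta>\<^sub>0 \<in> \<Theta>"
    and "prob_space M"
    and "distributed M lborel Z std_gaussian_density"
  shows "(AE \<omega> in M. ((\<lambda>\<sigma>. proj_estimator \<Theta> \<theta>\<^sub>0 Z \<sigma> \<omega>)
            \<longlongrightarrow> limit_estimator \<Theta> \<theta>\<^sub>0 Z \<omega>) at_top) \<and>
         (\<forall>\<sigma>>0. integrable M (\<lambda>\<omega>. (norm (proj_estimator \<Theta> \<theta>\<^sub>0 Z \<sigma> \<omega> - \<theta>\<^sub>0))\<^sup>2)) \<and>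
         integrable M (\<lambda>\<omega>. (norm (limit_estimator \<Theta> \<theta>\<^sub>0 Z \<omega> - \<theta>\<^sub>0))\<^sup>2) \<and>
         ((\<lambda>\<sigma>. risk M Z \<theta>\<^sub>0 \<Theta> \<sigma>) \<longlongrightarrow> limit_risk M Z \<theta>\<^sub>0 \<Theta>) at_top"
proof -
  interpret prob_space M by fact
  have Z: "Z \<in> borel_measurable M"
    using distributed_measurable[OF assms(6)] by simp
  note [measurable] = borel_measurable_proj_estimator[OF assms(1-3) Z]
    borel_measurable_limit_estimator[OF assms(1-3) Z]
  have conv: "((\<lambda>\<sigma>. proj_estimator \<Theta> \<theta>\<^sub>0 Z \<sigma> \<omega>) \<longlongrightarrow> limit_estimator \<Theta> \<theta>\<^sub>0 Z \<omega>) at_top" for \<omega>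
    using assms(1-3) by (rule proj_estimator_tendsto_limit_estimator)
  define D where "D = (diameter \<Theta>)\<^sup>2"
  have D: "norm ((norm (x - \<theta>\<^sub>0))\<^sup>2) \<le> D" if "x \<in> \<Theta>" for x
  proof -
    have "norm (x - \<theta>\<^sub>0) \<le> diameter \<Theta>"
      using diameter_bounded_bound[OF compact_imp_bounded[OF assms(2)] that assms(4)]
      by (simp add: dist_norm)
    then show ?thesis
      by (simp add: D_def power_mono)
  qed
  note bound_proj = D[OF proj_estimator_in_set[OF assms(1,2)]]
  note bound_limit = D[OF limit_estimator_in_set[OF assms(1,2)]]
  have "integrable M (\<lambda>\<omega>. (norm (proj_estimator \<Theta> \<theta>\<^sub>0 Z \<sigma> \<omega> - \<theta>\<^sub>0))\<^sup>2)" for \<sigma>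
    by (intro integrable_const_bound[where B = D] AE_I2 bound_proj) measurable
  moreover have "integrable M (\<lambda>\<omega>. (norm (limit_estimator \<Theta> \<theta>\<^sub>0 Z \<omega> - \<theta>\<^sub>0))\<^sup>2)"
    by (intro integrable_const_bound[where B = D] AE_I2 bound_limit) measurable
  moreover have "((\<lambda>\<sigma>. risk M Z \<theta>\<^sub>0 \<Theta> \<sigma>) \<longlongrightarrow> limit_risk M Z \<theta>\<^sub>0 \<Theta>) at_top"
    unfolding risk_def limit_risk_def
  proof (rule integral_dominated_convergence_at_top[where w = "\<lambda>_. D"])
    show "AE \<omega> in M. ((\<lambda>\<sigma>. (norm (proj_estimator \<Theta> \<theta>\<^sub>0 Z \<sigma> \<omega> - \<theta>\<^sub>0))\<^sup>2)
        \<longlongrightarrow> (norm (limit_estimator \<Theta> \<theta>\<^sub>0 Z \<omega> - \<theta>\<^sub>0))\<^sup>2) at_top"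
      by (intro AE_I2 tendsto_intros conv)
    show "\<forall>\<^sub>F \<sigma> in at_top. AE \<omega> in M. norm ((norm (proj_estimator \<Theta> \<theta>\<^sub>0 Z \<sigma> \<omega> - \<theta>\<^sub>0))\<^sup>2) \<le> D"
      by (intro always_eventually allI AE_I2 bound_proj)
  qed measurable
  ultimately show ?thesis
    using conv by blast
qed

end
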